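(* Let $X$ be a rectangular domain in $1+1$ spacetime dimensions with rectangular mesh $\mathcal{T}(X)=\{\Box_{ab}\}_{a,b}$, with one quadrature point along each edge of each element. Let $H_d^+$ be the associated discrete boundary Hamiltonian and $S_d$ the associated discrete action sum (as defined in the context). The Type II variational principle $\delta S_d=0$, subject to variations of $\varphi$ vanishing along $A(X)$ and variations of $\pi$ vanishing along $B(X)$, yields the following, for every $\Box_{ab}\in\mathcal{T}(X)$: $$\pi^1_{[a]b}=\frac{1}{\Delta t}D_1H_d^+(\varphi_{[a]b},\varphi_{a[b]},\pi^1_{[a]b+1},\pi^0_{a+1[b]}),$$ $$\pi^0_{a[b]}=\frac{1}{\Delta x}D_2H_d^+(\varphi_{[a]b},\varphi_{a[b]},\pi^1_{[a]b+1},\pi^0_{a+1[b]}),$$ $$\varphi_{[a]b+1}=\frac{1}{\Delta t}D_3H_d^+(\varphi_{[a]b},\varphi_{a[b]},\pi^1_{[a]b+1},\pi^0_{a+1[b]}),$$ $$\varphi_{a+1[b]}=\frac{1}{\Delta x}D_4H_d^+(\varphi_{[a]b},\varphi_{a[b]},\pi^1_{[a]b+1},\pi^0_{a+1[b]}),$$ where $D_i$ denotes differentiation with respect to the $i$-th argument. These equations are referred to as the discrete forward Hamilton's equations (in the case of one quadrature point). These equations define a map $$(\varphi_A,\pi_B)=(\varphi_{[a]b},\varphi_{a[b]},\pi^1_{[a]b+1},\pi^0_{a+1[b]})\mapsto(\varphi_B,\pi_A)=(\varphi_{[a]b+1},\varphi_{a+1[b]},\pi^1_{[a]b},\pi^0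_{a[b]}).$$
   Context: Fields take values in a vector space $Q$ and momenta in its dual $Q^*$; juxtaposition $\pi\varphi$ denotes the duality pairing. The domain is $X=[t_0,t_0+N\Delta t]\times[x_0,x_0+M\Delta x]$, with mesh elements $\Box_{ab}=[t_0+a\Delta t,t_0+(a+1)\Delta t]\times[x_0+b\Delta x,x_0+(b+1)\Delta x]$, $a=0,\dots,N-1$, $b=0,\dots,M-1$; write $t_a=t_0+a\Delta t$, $x_b=x_0+b\Delta x$. There is one quadrature point on each edge, with quadrature weight $\Delta t$ for temporal edges and $\Delta x$ for spatial edges. $\varphi_{[a]b}\in Q$ is the field value at the quadrature point on the edge $(t_a,t_{a+1})\times\{x_b\}$, and $\pi^1_{[a]b}\in Q^*$ is the normal momentum there (the momentum associated to the $x$ direction). $\varphi_{a[b]}\in Q$ is the field value at the quadrature point on the edge $\{t_a\}\times(x_b,x_{b+1})$, and $\pi^0_{a[b]}\in Q^*$ is the normal momentum there (the momentum associated to the $t$ direction). The boundary of each element is partitioned as $\partial\Box_{ab}=A\cup B$, where $A=A(\Box_{ab})$ consists of the edges at $t=t_a$ and $x=x_b$, and $B=B(\Box_{ab})$ consists of the edges at $t=t_{a+1}$ and $x=x_{b+1}$. Correspondingly $\partial X=A(X)\cup B(X)$, where $A(X)$ is the union over elements of $A(\Box)\cap\partial X$ (the edges of $X$ at $t=t_0$ and $x=x_0$) and $B(X)$ is the union over elements of $B(\Box)\cap\partial X$ (the edges of $X$ at $t=t_0+N\Delta t$ and $x=x_0+M\Delta x$). The discrete boundary Hamiltonian is $$H_d^+(\varphi_{[a]b},\varphi_{a[b]},\pi^1_{[a]b+1},\pi^0_{a+1[b]})=\operatorname{ext}\Big(\pi^1_{[a]b+1}\varphi_{[a]b+1}\Delta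 t+\pi^0_{a+1[b]}\varphi_{a+1[b]}\Delta x-S_d^{\Box_{ab}}[\phi,p]\Big),$$ where $\operatorname{ext}$ denotes the extremal (stationary) value over discrete fields and momenta $(\phi,p)$ on $\Box_{ab}$ satisfying the prescribed boundary conditions (field values on $A$, normal momenta on $B$), and $S_d^{\Box_{ab}}[\phi,p]$ is some discrete approximation of the action $\int_{\Box_{ab}}(p^\mu\partial_\mu\phi-H(\phi,p))\,dt\,dx$ of the Hamiltonian field theory with Hamiltonian $H$. The discrete action sum is $$S_d=\sum_{a=0}^{N-1}\pi^1_{[a]M}\varphi_{[a]M}\Delta t+\sum_{b=0}^{M-1}\pi^0_{N[b]}\varphi_{N[b]}\Delta x-\sum_{a=0}^{N-1}\sum_{b=0}^{M-1}\Big[\pi^1_{[a]b+1}\varphi_{[a]b+1}\Delta t+\pi^0_{a+1[b]}\varphi_{a+1[b]}\Delta x-H_d^+(\varphi_{[a]b},\varphi_{a[b]},\pi^1_{[a]b+1},\pi^0_{a+1[b]})\Big].$$ The conditions on the variations are $\delta\varphi_{[a]0}=0$, $\delta\varphi_{0[b]}=0$, $\delta\pi^1_{[a]M}=0$, $\delta\pi^0_{N[b]}=0$.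
   Formalization: δS_d=0 cannot constrain π on A(X) or φ on B(X), as S_d does not depend on them; equations for these values are not derived but shown to hold for exactly one choice of them. Q is a reflexive normed space; H_d^+ is assumed well defined and differentiable. *)

theory Defs
  imports "HOL-Analysis.Analysis"
begin

section \<open>The dual of the field space\<close>

type_synonym 'q dual = "'q \<Rightarrow>\<^sub>L real"

text \<open>The derivative of a function on a dual space is an element of the bidual.  It is regarded as
  an element of \<open>'q\<close> through the canonical map below, which is a bijection exactly when \<open>'q\<close> is
  reflexive; \<open>bij_bidual_embed_euclidean\<close> records that this is automatic in finite dimension.\<close>

definition bidual_embed :: "'q::real_normed_vector \<Rightarrow> 'q dual dual" where
  "bidual_embed q = Blinfun (\<lambda>p. blinfun_apply p q)"

lemma bidual_embed_apply [simp]: "blinfun_apply (bidual_embed q) p = blinfun_apply p q"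
  unfolding bidual_embed_def
  by (simp add: bounded_linear_Blinfun_apply blinfun.bounded_linear_left)

lemma bij_bidual_embed_euclidean:
  "bij (bidual_embed :: 'q::euclidean_space \<Rightarrow> 'q dual dual)"
proof (rule bijI)
  show "inj (bidual_embed :: 'q \<Rightarrow> 'q dual dual)"
  proof (rule injI)
    fix x y :: 'q
    assume eq: "bidual_embed x = bidual_embed y"
    have "z \<bullet> x = z \<bullet> y" for z
      using arg_cong[OF eq, of "\<lambda>l. blinfun_apply l (blinfun_inner_right z)"] by simp
    then show "x = y"
      using vector_eq_ldot by blast
  qed
  show "surj (bidual_embed :: 'q \<Rightarrow> 'q dual dual)"
  proof (rule surjI)
    fix l :: "'q dual dual"
    let ?q = "\<Sum>i\<in>Basis. blinfun_apply l (blinfun_inner_right i) *\<^sub>R i"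
    show "bidual_embed ?q = l"
    proof (rule blinfun_eqI)
      fix p :: "'q dual"
      have p: "p = (\<Sum>i\<in>Basis. blinfun_apply p i *\<^sub>R blinfun_inner_right i)"
      proof (rule blinfun_eqI)
        fix x :: 'q
        have "blinfun_apply p x = blinfun_apply p (\<Sum>i\<in>Basis. (x \<bullet> i) *\<^sub>R i)"
          by (simp add: euclidean_representation)
        also have "\<dots> = (\<Sum>i\<in>Basis. (x \<bullet> i) * blinfun_apply p i)"
          by (simp add: blinfun.sum_right blinfun.scaleR_right)
        finally show "blinfun_apply p x
            = blinfun_apply (\<Sum>i\<in>Basis. blinfun_apply p i *\<^sub>R blinfun_inner_right i) x"
          by (simp add: blinfun.sum_left blinfun.scaleR_left inner_commute mult.commute)
      qed
      have "blinfun_apply l p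
          = blinfun_apply l (\<Sum>i\<in>Basis. blinfun_apply p i *\<^sub>R blinfun_inner_right i)"
        using p by simp
      also have "\<dots> = (\<Sum>i\<in>Basis. blinfun_apply p i * blinfun_apply l (blinfun_inner_right i))"
        by (simp add: blinfun.sum_right blinfun.scaleR_right)
      finally show "blinfun_apply (bidual_embed ?q) p = blinfun_apply l p"
        by (simp add: blinfun.sum_right blinfun.scaleR_right mult.commute)
    qed
  qed
qed

definition differential :: "('v::real_normed_vector \<Rightarrow> real) \<Rightarrow> 'v \<Rightarrow> 'v dual" where
  "differential f x = Blinfun (frechet_derivative f (at x))"

definition D1 :: "('q::real_normed_vector \<Rightarrow> 'q \<Rightarrow> 'q dual \<Rightarrow> 'q dual \<Rightarrow> real)
    \<Rightarrow> 'q \<Rightarrow> 'q \<Rightarrow> 'q dual \<Rightarrow> 'q dual \<Rightarrow> 'q dual" where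
  "D1 H u v p r = differential (\<lambda>u. H u v p r) u"

definition D2 :: "('q::real_normed_vector \<Rightarrow> 'q \<Rightarrow> 'q dual \<Rightarrow> 'q dual \<Rightarrow> real)
    \<Rightarrow> 'q \<Rightarrow> 'q \<Rightarrow> 'q dual \<Rightarrow> 'q dual \<Rightarrow> 'q dual" where
  "D2 H u v p r = differential (\<lambda>v. H u v p r) v"

definition D3 :: "('q::real_normed_vector \<Rightarrow> 'q \<Rightarrow> 'q dual \<Rightarrow> 'q dual \<Rightarrow> real)
    \<Rightarrow> 'q \<Rightarrow> 'q \<Rightarrow> 'q dual \<Rightarrow> 'q dual \<Rightarrow> 'q" where
  "D3 H u v p r = inv bidual_embed (differential (\<lambda>p. H u v p r) p)"

definition D4 :: "('q::real_normed_vector \<Rightarrow> 'q \<Rightarrow> 'q dual \<Rightarrow> 'q dual \<Rightarrow> real)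
    \<Rightarrow> 'q \<Rightarrow> 'q \<Rightarrow> 'q dual \<Rightarrow> 'q dual \<Rightarrow> 'q" where
  "D4 H u v p r = inv bidual_embed (differential (\<lambda>r. H u v p r) r)"


section \<open>The mesh\<close>

text \<open>\<open>Temporal a b\<close> is the edge \<open>(t_a, t_(a+1)) \<times> {x_b}\<close>, written \<open>[a]b\<close> in subscripts, and
  \<open>Spatial a b\<close> is the edge \<open>{t_a} \<times> (x_b, x_(b+1))\<close>, written \<open>a[b]\<close>.  As each edge carries exactly
  one quadrature point, edges also index the edge values of fields and normal momenta.  The
  origin \<open>(t_0, x_0)\<close> of the mesh does not enter.\<close>

datatype edge = Temporal nat nat | Spatial nat nat

definition A_elem :: "nat \<Rightarrow> nat \<Rightarrow> edge set" where
  "A_elem a b = {Temporal a b, Spatial a b}"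

definition B_elem :: "nat \<Rightarrow> nat \<Rightarrow> edge set" where
  "B_elem a b = {Temporal a (b + 1), Spatial (a + 1) b}"

definition mesh_boundary :: "nat \<Rightarrow> nat \<Rightarrow> edge set" where
  "mesh_boundary N M =
     {Temporal a b | a b. a < N \<and> (b = 0 \<or> b = M)} \<union>
     {Spatial a b | a b. b < M \<and> (a = 0 \<or> a = N)}"

definition A_mesh :: "nat \<Rightarrow> nat \<Rightarrow> edge set" where
  "A_mesh N M = (\<Union>a<N. \<Union>b<M. A_elem a b \<inter> mesh_boundary N M)"

definition B_mesh :: "nat \<Rightarrow> nat \<Rightarrow> edge set" where
  "B_mesh N M = (\<Union>a<N. \<Union>b<M. B_elem a b \<inter> mesh_boundary N M)"

lemma Temporal_A_mesh: "0 < M \<Longrightarrow> Temporal a b \<in> A_mesh N M \<longleftrightarrow> a < N \<and> b = 0"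
  and Spatial_A_mesh: "0 < N \<Longrightarrow> Spatial a b \<in> A_mesh N M \<longleftrightarrow> b < M \<and> a = 0"
  by (auto simp: A_mesh_def A_elem_def mesh_boundary_def)

lemma Temporal_B_mesh: "0 < M \<Longrightarrow> Temporal a b \<in> B_mesh N M \<longleftrightarrow> a < N \<and> b = M"
proof -
  assume "0 < M"
  then obtain m where "M = Suc m" using gr0_implies_Suc by blast
  then show ?thesis
    by (auto simp: B_mesh_def B_elem_def mesh_boundary_def)
qed

lemma Spatial_B_mesh: "0 < N \<Longrightarrow> Spatial a b \<in> B_mesh N M \<longleftrightarrow> b < M \<and> a = N"
proof -
  assume "0 < N"
  then obtain n where "N = Suc n" using gr0_implies_Suc by blast
  then show ?thesis
    by (auto simp: B_mesh_def B_elem_def mesh_boundary_def)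
qed


section \<open>The discrete boundary Hamiltonian\<close>

text \<open>A discretization of the theory on the elements: \<open>'e\<close> is the vector space of discrete pairs
  \<open>(\<phi>, p)\<close> on an element, \<open>elem_action D a b\<close> is the discrete action of the element with indices
  \<open>a, b\<close>, and \<open>field_at D a b e\<close>, \<open>mom_at D a b e\<close> return the field value and the normal momentum
  at the quadrature point of the edge \<open>e\<close> of that element.  The discrete action may be any
  function, since which approximation of the continuum action it is plays no role.\<close>

record (overloaded) ('q, 'e) discretization =
  elem_action :: "nat \<Rightarrow> nat \<Rightarrow> 'e \<Rightarrow> real"
  field_at :: "nat \<Rightarrow> nat \<Rightarrow> edge \<Rightarrow> 'e \<Rightarrow> 'q"
  mom_at :: "nat \<Rightarrow> nat \<Rightarrow> edge \<Rightarrow> 'e \<Rightarrow> 'q \<Rightarrow>\<^sub>L real"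

definition linear_traces ::
    "('q::real_normed_vector, 'e::real_vector) discretization \<Rightarrow> nat \<Rightarrow> nat \<Rightarrow> bool" where
  "linear_traces D a b \<longleftrightarrow>
     (\<forall>e \<in> A_elem a b \<union> B_elem a b. linear (field_at D a b e) \<and> linear (mom_at D a b e))"

text \<open>Stationary values of \<open>F\<close> on an affine subspace \<open>K\<close> with direction space \<open>V\<close>.\<close>

definition stationary_value :: "('e::real_vector \<Rightarrow> real) \<Rightarrow> 'e set \<Rightarrow> 'e set \<Rightarrow> real \<Rightarrow> bool" where
  "stationary_value F K V c \<longleftrightarrow>
     (\<exists>w\<in>K. (\<forall>d\<in>V. ((\<lambda>\<epsilon>. F (w + \<epsilon> *\<^sub>R d)) has_real_derivative 0) (at 0)) \<and> c = F w)"

definition elem_fields :: "('q::real_normed_vector, 'e::real_vector) discretization \<Rightarrow> nat \<Rightarrow> nat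
    \<Rightarrow> 'q \<Rightarrow> 'q \<Rightarrow> 'q dual \<Rightarrow> 'q dual \<Rightarrow> 'e set" where
  "elem_fields D a b u v p r =
     {w. field_at D a b (Temporal a b) w = u \<and>
         field_at D a b (Spatial a b) w = v \<and>
         mom_at D a b (Temporal a (b + 1)) w = p \<and>
         mom_at D a b (Spatial (a + 1) b) w = r}"

definition elem_functional :: "('q::real_normed_vector, 'e::real_vector) discretization
    \<Rightarrow> real \<Rightarrow> real \<Rightarrow> nat \<Rightarrow> nat \<Rightarrow> 'e \<Rightarrow> real" where
  "elem_functional D dt dx a b w =
     blinfun_apply (mom_at D a b (Temporal a (b + 1)) w) (field_at D a b (Temporal a (b + 1)) w) * dt
   + blinfun_apply (mom_at D a b (Spatial (a + 1) b) w) (field_at D a b (Spatial (a + 1) b) w) * dx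
   - elem_action D a b w"

text \<open>Variations of an element of \<open>elem_fields D a b u v p r\<close> range over
  \<open>elem_fields D a b 0 0 0 0\<close>, the traces being linear.\<close>

definition ham_stationary_value :: "('q::real_normed_vector, 'e::real_vector) discretization
    \<Rightarrow> real \<Rightarrow> real \<Rightarrow> nat \<Rightarrow> nat \<Rightarrow> 'q \<Rightarrow> 'q \<Rightarrow> 'q dual \<Rightarrow> 'q dual \<Rightarrow> real \<Rightarrow> bool" where
  "ham_stationary_value D dt dx a b u v p r =
     stationary_value (elem_functional D dt dx a b)
       (elem_fields D a b u v p r) (elem_fields D a b 0 0 0 0)"

definition bdry_ham :: "('q::real_normed_vector, 'e::real_vector) discretization
    \<Rightarrow> real \<Rightarrow> real \<Rightarrow> nat \<Rightarrow> nat \<Rightarrow> 'q \<Rightarrow> 'q \<Rightarrow> 'q dual \<Rightarrow> 'q dual \<Rightarrow> real" where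
  "bdry_ham D dt dx a b u v p r = (THE c. ham_stationary_value D dt dx a b u v p r c)"

definition bdry_ham_well_defined :: "('q::real_normed_vector, 'e::real_vector) discretization
    \<Rightarrow> real \<Rightarrow> real \<Rightarrow> nat \<Rightarrow> nat \<Rightarrow> bool" where
  "bdry_ham_well_defined D dt dx a b \<longleftrightarrow>
     (\<forall>u v p r. \<exists>!c. ham_stationary_value D dt dx a b u v p r c)"

definition bdry_ham_differentiable :: "('q::real_normed_vector, 'e::real_vector) discretization
    \<Rightarrow> real \<Rightarrow> real \<Rightarrow> nat \<Rightarrow> nat \<Rightarrow> bool" where
  "bdry_ham_differentiable D dt dx a b \<longleftrightarrow>
     (\<forall>z. (\<lambda>(u, v, p, r). bdry_ham D dt dx a b u v p r) differentiable (at z))"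


section \<open>The Type II variational principle\<close>

definition action_sum :: "('q::real_normed_vector, 'e::real_vector) discretization
    \<Rightarrow> nat \<Rightarrow> nat \<Rightarrow> real \<Rightarrow> real \<Rightarrow> (edge \<Rightarrow> 'q) \<Rightarrow> (edge \<Rightarrow> 'q dual) \<Rightarrow> real" where
  "action_sum D N M dt dx \<phi> \<pi> =
     (\<Sum>a<N. blinfun_apply (\<pi> (Temporal a M)) (\<phi> (Temporal a M)) * dt)
   + (\<Sum>b<M. blinfun_apply (\<pi> (Spatial N b)) (\<phi> (Spatial N b)) * dx)
   - (\<Sum>a<N. \<Sum>b<M.
        blinfun_apply (\<pi> (Temporal a (b + 1))) (\<phi> (Temporal a (b + 1))) * dt
      + blinfun_apply (\<pi> (Spatial (a + 1) b)) (\<phi> (Spatial (a + 1) b)) * dx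
      - bdry_ham D dt dx a b (\<phi> (Temporal a b)) (\<phi> (Spatial a b))
          (\<pi> (Temporal a (b + 1))) (\<pi> (Spatial (a + 1) b)))"

definition type_II_stationary :: "('q::real_normed_vector, 'e::real_vector) discretization
    \<Rightarrow> nat \<Rightarrow> nat \<Rightarrow> real \<Rightarrow> real \<Rightarrow> (edge \<Rightarrow> 'q) \<Rightarrow> (edge \<Rightarrow> 'q dual) \<Rightarrow> bool" where
  "type_II_stationary D N M dt dx \<phi> \<pi> \<longleftrightarrow>
     (\<forall>\<delta>\<phi> \<delta>\<pi>. (\<forall>e\<in>A_mesh N M. \<delta>\<phi> e = 0) \<and> (\<forall>e\<in>B_mesh N M. \<delta>\<pi> e = 0) \<longrightarrow>
        ((\<lambda>\<epsilon>. action_sum D N M dt dx (\<lambda>e. \<phi> e + \<epsilon> *\<^sub>R \<delta>\<phi> e) (\<lambda>e. \<pi> e + \<epsilon> *\<^sub>R \<delta>\<pi> e))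
           has_real_derivative 0) (at 0))"

text \<open>The discrete forward Hamilton's equations of one element, as a relation between
  \<open>(\<phi>_A, \<pi>_B) = (u, v, p, r)\<close> and \<open>(\<phi>_B, \<pi>_A) = (u', v', p', r')\<close>.\<close>

definition forward_hamilton :: "('q::real_normed_vector, 'e::real_vector) discretization
    \<Rightarrow> real \<Rightarrow> real \<Rightarrow> nat \<Rightarrow> nat
    \<Rightarrow> 'q \<times> 'q \<times> 'q dual \<times> 'q dual \<Rightarrow> 'q \<times> 'q \<times> 'q dual \<times> 'q dual \<Rightarrow> bool" where
  "forward_hamilton D dt dx a b = (\<lambda>(u, v, p, r) (u', v', p', r').
     p' = (1 / dt) *\<^sub>R D1 (bdry_ham D dt dx a b) u v p r \<and>
     r' = (1 / dx) *\<^sub>R D2 (bdry_ham D dt dx a b) u v p r \<and>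
     u' = (1 / dt) *\<^sub>R D3 (bdry_ham D dt dx a b) u v p r \<and>
     v' = (1 / dx) *\<^sub>R D4 (bdry_ham D dt dx a b) u v p r)"

definition phiA_piB :: "nat \<Rightarrow> nat \<Rightarrow> (edge \<Rightarrow> 'q::real_normed_vector) \<Rightarrow> (edge \<Rightarrow> 'q dual)
    \<Rightarrow> 'q \<times> 'q \<times> 'q dual \<times> 'q dual" where
  "phiA_piB a b \<phi> \<pi> =
     (\<phi> (Temporal a b), \<phi> (Spatial a b), \<pi> (Temporal a (b + 1)), \<pi> (Spatial (a + 1) b))"

definition phiB_piA :: "nat \<Rightarrow> nat \<Rightarrow> (edge \<Rightarrow> 'q::real_normed_vector) \<Rightarrow> (edge \<Rightarrow> 'q dual)
    \<Rightarrow> 'q \<times> 'q \<times> 'q dual \<times> 'q dual" where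
  "phiB_piA a b \<phi> \<pi> =
     (\<phi> (Temporal a (b + 1)), \<phi> (Spatial (a + 1) b), \<pi> (Temporal a b), \<pi> (Spatial a b))"

text \<open>The action sum does not involve the values of \<open>\<phi>\<close> on \<open>B(X)\<close> (they cancel against the
  boundary terms) nor those of \<open>\<pi>\<close> on \<open>A(X)\<close>.  No variational principle for it can therefore
  constrain these values: there the forward Hamilton's equations act as their definition.\<close>

lemma action_sum_cong:
  assumes NM: "0 < N" "0 < M"
    and \<phi>: "\<And>e. e \<notin> B_mesh N M \<Longrightarrow> \<phi>' e = \<phi> e"
    and \<pi>: "\<And>e. e \<notin> A_mesh N M \<Longrightarrow> \<pi>' e = \<pi> e"
  shows "action_sum D N M dt dx \<phi>' \<pi>' = action_sum D N M dt dx \<phi> \<pi>"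
proof -
  note mesh = Temporal_A_mesh[OF NM(2)] Spatial_A_mesh[OF NM(1)]
    Temporal_B_mesh[OF NM(2)] Spatial_B_mesh[OF NM(1)]
  obtain n m where Suc: "N = Suc n" "M = Suc m"
    using NM gr0_implies_Suc by blast
  have cancel: "action_sum D N M dt dx f g =
      - (\<Sum>a<N. \<Sum>b<m. blinfun_apply (g (Temporal a (b + 1))) (f (Temporal a (b + 1))) * dt)
      - (\<Sum>a<n. \<Sum>b<M. blinfun_apply (g (Spatial (a + 1) b)) (f (Spatial (a + 1) b)) * dx)
      + (\<Sum>a<N. \<Sum>b<M. bdry_ham D dt dx a b (f (Temporal a b)) (f (Spatial a b))
          (g (Temporal a (b + 1))) (g (Spatial (a + 1) b)))" for f g
  proof -
    have "(\<Sum>a<N. \<Sum>b<M. blinfun_apply (g (Temporal a (b + 1))) (f (Temporal a (b + 1))) * dt)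
      = (\<Sum>a<N. \<Sum>b<m. blinfun_apply (g (Temporal a (b + 1))) (f (Temporal a (b + 1))) * dt)
        + (\<Sum>a<N. blinfun_apply (g (Temporal a M)) (f (Temporal a M)) * dt)"
      unfolding Suc(2) by (simp add: sum.distrib)
    moreover have
      "(\<Sum>a<N. \<Sum>b<M. blinfun_apply (g (Spatial (a + 1) b)) (f (Spatial (a + 1) b)) * dx)
      = (\<Sum>a<n. \<Sum>b<M. blinfun_apply (g (Spatial (a + 1) b)) (f (Spatial (a + 1) b)) * dx)
        + (\<Sum>b<M. blinfun_apply (g (Spatial N b)) (f (Spatial N b)) * dx)"
      unfolding Suc(1) by simp
    ultimately show ?thesis
      unfolding action_sum_def by (simp only: sum.distrib sum_subtractf)
  qed
  have \<phi>T: "\<phi>' (Temporal a b) = \<phi> (Temporal a b)" if "b < M" for a b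
    using that by (intro \<phi>) (simp add: mesh)
  have \<phi>S: "\<phi>' (Spatial a b) = \<phi> (Spatial a b)" if "a < N" for a b
    using that by (intro \<phi>) (simp add: mesh)
  have \<pi>T: "\<pi>' (Temporal a (b + 1)) = \<pi> (Temporal a (b + 1))" for a b
    by (intro \<pi>) (simp add: mesh)
  have \<pi>S: "\<pi>' (Spatial (a + 1) b) = \<pi> (Spatial (a + 1) b)" for a b
    by (intro \<pi>) (simp add: mesh)
  have s1: "(\<Sum>a<N. \<Sum>b<m. blinfun_apply (\<pi>' (Temporal a (b + 1))) (\<phi>' (Temporal a (b + 1))) * dt)
      = (\<Sum>a<N. \<Sum>b<m. blinfun_apply (\<pi> (Temporal a (b + 1))) (\<phi> (Temporal a (b + 1))) * dt)"
  proof (intro sum.cong refl)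
    fix a b assume "b \<in> {..<m}"
    then have "b + 1 < M" using Suc(2) by simp
    then show "blinfun_apply (\<pi>' (Temporal a (b + 1))) (\<phi>' (Temporal a (b + 1))) * dt
      = blinfun_apply (\<pi> (Temporal a (b + 1))) (\<phi> (Temporal a (b + 1))) * dt"
      by (simp only: \<phi>T \<pi>T)
  qed
  have s2: "(\<Sum>a<n. \<Sum>b<M. blinfun_apply (\<pi>' (Spatial (a + 1) b)) (\<phi>' (Spatial (a + 1) b)) * dx)
      = (\<Sum>a<n. \<Sum>b<M. blinfun_apply (\<pi> (Spatial (a + 1) b)) (\<phi> (Spatial (a + 1) b)) * dx)"
  proof (intro sum.cong refl)
    fix a b assume "a \<in> {..<n}"
    then have "a + 1 < N" using Suc(1) by simp
    then show "blinfun_apply (\<pi>' (Spatial (a + 1) b)) (\<phi>' (Spatial (a + 1) b)) * dx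
      = blinfun_apply (\<pi> (Spatial (a + 1) b)) (\<phi> (Spatial (a + 1) b)) * dx"
      by (simp only: \<phi>S \<pi>S)
  qed
  have s3: "(\<Sum>a<N. \<Sum>b<M. bdry_ham D dt dx a b (\<phi>' (Temporal a b)) (\<phi>' (Spatial a b))
          (\<pi>' (Temporal a (b + 1))) (\<pi>' (Spatial (a + 1) b)))
      = (\<Sum>a<N. \<Sum>b<M. bdry_ham D dt dx a b (\<phi> (Temporal a b)) (\<phi> (Spatial a b))
          (\<pi> (Temporal a (b + 1))) (\<pi> (Spatial (a + 1) b)))"
  proof (intro sum.cong refl)
    fix a b assume "a \<in> {..<N}" "b \<in> {..<M}"
    then have "a < N" "b < M" by simp_all
    then show "bdry_ham D dt dx a b (\<phi>' (Temporal a b)) (\<phi>' (Spatial a b))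
          (\<pi>' (Temporal a (b + 1))) (\<pi>' (Spatial (a + 1) b))
      = bdry_ham D dt dx a b (\<phi> (Temporal a b)) (\<phi> (Spatial a b))
          (\<pi> (Temporal a (b + 1))) (\<pi> (Spatial (a + 1) b))"
      by (simp only: \<phi>T \<phi>S \<pi>T \<pi>S)
  qed
  show ?thesis
    unfolding cancel s1 s2 s3 ..
qed

end

theory Submission
  imports Defs
begin

text \<open>The discrete Euler--Lagrange argument: summation by parts over the mesh, with the boundary
  terms of the action sum and the conditions on the variations absorbing the edges on the boundary,
  writes the first variation as a sum over elements of the residuals of the forward Hamilton's
  equations, each tested against an independent edge value.  The action sum is blind to the field on
  the outflow boundary and to the momentum on the inflow boundary, so there the equations can be
  read as definitions.\<close>

section \<open>Partial derivatives and the bidual identification\<close>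

lemma blinfun_apply_differential:
  assumes "(f has_derivative f') (at x)"
  shows "blinfun_apply (differential f x) = f'"
  using assms has_derivative_bounded_linear[OF assms]
  by (simp add: differential_def frechet_derivative_at[OF assms, symmetric]
      bounded_linear_Blinfun_apply)

text \<open>Surjectivity of \<open>bidual_embed\<close> makes \<open>inv\<close> a right inverse, so
  the field-valued \<open>D3\<close> and \<open>D4\<close> pair with a momentum exactly as the
  bidual-valued differentials behind them do.\<close>

lemma blinfun_apply_inv_bidual_embed:
  fixes L :: "'q::real_normed_vector dual dual"
  assumes "bij (bidual_embed :: 'q \<Rightarrow> 'q dual dual)"
  shows "blinfun_apply k (inv bidual_embed L) = blinfun_apply L k"
  using bidual_embed_apply[of "inv bidual_embed L" k]
    surj_f_inv_f[OF bij_is_surj[OF assms], of L] by simp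

text \<open>Injectivity of \<open>bidual_embed\<close> says that momenta separate field values;
  field-valued equations are proved by this test.\<close>

lemma bidual_embed_eqI:
  fixes x y :: "'q::real_normed_vector"
  assumes "bij (bidual_embed :: 'q \<Rightarrow> 'q dual dual)"
    and "\<And>k :: 'q dual. blinfun_apply k x = blinfun_apply k y"
  shows "x = y"
proof -
  have "bidual_embed x = bidual_embed y"
    by (rule blinfun_eqI) (simp add: assms(2))
  then show ?thesis
    using bij_is_inj[OF assms(1)] by (simp add: inj_eq)
qed

text \<open>The joint derivative exists by assumption; restricting it along the four coordinate
  inclusions identifies its components with the partial derivatives.\<close>

lemma has_derivative_partials:
  fixes H :: "'q::real_normed_vector \<Rightarrow> 'q \<Rightarrow> 'q dual \<Rightarrow> 'q dual \<Rightarrow> real"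
  assumes bidual: "bij (bidual_embed :: 'q \<Rightarrow> 'q dual dual)"
    and diff: "(\<lambda>(u, v, p, r). H u v p r) differentiable (at (u, v, p, r))"
  shows "((\<lambda>(u, v, p, r). H u v p r) has_derivative
    (\<lambda>(x, y, k, l). blinfun_apply (D1 H u v p r) x + blinfun_apply (D2 H u v p r) y
       + blinfun_apply k (D3 H u v p r) + blinfun_apply l (D4 H u v p r))) (at (u, v, p, r))"
proof -
  let ?F = "\<lambda>(u, v, p, r). H u v p r"
  obtain F' where F': "(?F has_derivative F') (at (u, v, p, r))"
    using diff unfolding differentiable_def by blast
  interpret F': bounded_linear F' by (rule has_derivative_bounded_linear[OF F'])
  \<comment> \<open>Chain rule for a map \<open>g\<close> into the product that meets the base point
    at \<open>s\<close>; below, \<open>g\<close> moves one coordinate and freezes the other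
    three.\<close>
  have comp: "((\<lambda>t. ?F (g t)) has_derivative (\<lambda>t. F' (g' t))) (at s)"
    if "(g has_derivative g') (at s)" "g s = (u, v, p, r)" for g g' and s :: "'s::real_normed_vector"
    using has_derivative_compose[OF that(1), of ?F F'] F' that(2) by simp
  have "((\<lambda>t. H t v p r) has_derivative (\<lambda>t. F' (t, 0, 0, 0))) (at u)"
    using comp[of "\<lambda>t. (t, v, p, r)" "\<lambda>t. (t, 0, 0, 0)" u] by (simp add: has_derivative_Pair)
  then have 1: "blinfun_apply (D1 H u v p r) = (\<lambda>t. F' (t, 0, 0, 0))"
    unfolding D1_def by (rule blinfun_apply_differential)
  have "((\<lambda>t. H u t p r) has_derivative (\<lambda>t. F' (0, t, 0, 0))) (at v)"
    using comp[of "\<lambda>t. (u, t, p, r)" "\<lambda>t. (0, t, 0, 0)" v] by (simp add: has_derivative_Pair)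
  then have 2: "blinfun_apply (D2 H u v p r) = (\<lambda>t. F' (0, t, 0, 0))"
    unfolding D2_def by (rule blinfun_apply_differential)
  have "((\<lambda>t. H u v t r) has_derivative (\<lambda>t. F' (0, 0, t, 0))) (at p)"
    using comp[of "\<lambda>t. (u, v, t, r)" "\<lambda>t. (0, 0, t, 0)" p] by (simp add: has_derivative_Pair)
  then have 3: "blinfun_apply k (D3 H u v p r) = F' (0, 0, k, 0)" for k
    unfolding D3_def blinfun_apply_inv_bidual_embed[OF bidual]
    using blinfun_apply_differential by fastforce
  have "((\<lambda>t. H u v p t) has_derivative (\<lambda>t. F' (0, 0, 0, t))) (at r)"
    using comp[of "\<lambda>t. (u, v, p, t)" "\<lambda>t. (0, 0, 0, t)" r] by (simp add: has_derivative_Pair)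
  then have 4: "blinfun_apply k (D4 H u v p r) = F' (0, 0, 0, k)" for k
    unfolding D4_def blinfun_apply_inv_bidual_embed[OF bidual]
    using blinfun_apply_differential by fastforce
  \<comment> \<open>An increment is the sum of its four coordinate parts, and \<open>F'\<close> is
    additive.\<close>
  have "F' = (\<lambda>(x, y, k, l). F' (x, 0, 0, 0) + F' (0, y, 0, 0) + F' (0, 0, k, 0) + F' (0, 0, 0, l))"
    by (auto simp: fun_eq_iff F'.add[symmetric])
  then show ?thesis
    using F' by (simp add: 1 2 3 4)
qed

lemma DERIV_affine_line:
  fixes H :: "'q::real_normed_vector \<Rightarrow> 'q \<Rightarrow> 'q dual \<Rightarrow> 'q dual \<Rightarrow> real"
  assumes bidual: "bij (bidual_embed :: 'q \<Rightarrow> 'q dual dual)"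
    and diff: "(\<lambda>(u, v, p, r). H u v p r) differentiable (at (u, v, p, r))"
  shows "((\<lambda>\<epsilon>. H (u + \<epsilon> *\<^sub>R x) (v + \<epsilon> *\<^sub>R y) (p + \<epsilon> *\<^sub>R k) (r + \<epsilon> *\<^sub>R l)) has_real_derivative
     blinfun_apply (D1 H u v p r) x + blinfun_apply (D2 H u v p r) y
       + blinfun_apply k (D3 H u v p r) + blinfun_apply l (D4 H u v p r)) (at 0)"
proof -
  let ?g = "\<lambda>\<epsilon>. (u + \<epsilon> *\<^sub>R x, v + \<epsilon> *\<^sub>R y, p + \<epsilon> *\<^sub>R k, r + \<epsilon> *\<^sub>R l)"
  have "(?g has_derivative (\<lambda>\<epsilon>. (\<epsilon> *\<^sub>R x, \<epsilon> *\<^sub>R y, \<epsilon> *\<^sub>R k, \<epsilon> *\<^sub>R l))) (at 0)"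
    by (auto intro!: derivative_eq_intros)
  \<comment> \<open>A real derivative is a linear map of the form multiplication by a constant;
    homogeneity of the four pairings pulls \<open>\<epsilon>\<close> out and exhibits the
    constant.\<close>
  from has_derivative_compose[OF this, of "\<lambda>(u, v, p, r). H u v p r"]
    has_derivative_partials[OF bidual diff]
  show ?thesis
    unfolding has_field_derivative_def
    by (force simp: blinfun.scaleR_right blinfun.scaleR_left algebra_simps
        elim!: has_derivative_eq_rhs)
qed

text \<open>By bilinearity the pairing is a quadratic polynomial in \<open>\<epsilon>\<close>, and
  its derivative at 0 is the linear coefficient.\<close>

lemma DERIV_pairing_line:
  "((\<lambda>\<epsilon>. blinfun_apply (p + \<epsilon> *\<^sub>R k) (u + \<epsilon> *\<^sub>R x)) has_real_derivative
     blinfun_apply p x + blinfun_apply k u) (at 0)"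
proof -
  have "(\<lambda>\<epsilon>. blinfun_apply (p + \<epsilon> *\<^sub>R k) (u + \<epsilon> *\<^sub>R x))
      = (\<lambda>\<epsilon>. blinfun_apply p u + \<epsilon> * (blinfun_apply p x + blinfun_apply k u)
          + \<epsilon> * \<epsilon> * blinfun_apply k x)"
    by (simp add: fun_eq_iff blinfun.add_left blinfun.add_right blinfun.scaleR_left
        blinfun.scaleR_right algebra_simps)
  then show ?thesis
    by (auto intro!: derivative_eq_intros)
qed

section \<open>The first variation of the action sum\<close>

text \<open>The source of summation by parts: it moves a sum over the far edges of the elements to
  their near edges, at the cost of one term at each end.\<close>

lemma sum_shift:
  fixes f :: "nat \<Rightarrow> 'a::ab_group_add"
  shows "(\<Sum>i<n. f (Suc i)) = (\<Sum>i<n. f i) + f n - f 0"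
  by (induction n) (auto simp: algebra_simps)

text \<open>One abbreviation serves all four partial derivatives: \<open>F\<close> stands for any of
  \<open>D1\<close> to \<open>D4\<close>, and the free type \<open>'w\<close> covers momentum values
  and field values alike.\<close>

definition ham_partial ::
  "(('q::real_normed_vector \<Rightarrow> 'q \<Rightarrow> 'q dual \<Rightarrow> 'q dual \<Rightarrow> real) \<Rightarrow> 'q \<Rightarrow> 'q \<Rightarrow> 'q dual \<Rightarrow> 'q dual \<Rightarrow> 'w)
    \<Rightarrow> ('q, 'e::real_vector) discretization \<Rightarrow> real \<Rightarrow> real
    \<Rightarrow> (edge \<Rightarrow> 'q) \<Rightarrow> (edge \<Rightarrow> 'q dual) \<Rightarrow> nat \<Rightarrow> nat \<Rightarrow> 'w" where
  "ham_partial F D dt dx \<phi> \<pi> a b = F (bdry_ham D dt dx a b) (\<phi> (Temporal a b)) (\<phi> (Spatial a b))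
      (\<pi> (Temporal a (Suc b))) (\<pi> (Spatial (Suc a) b))"

text \<open>Field variations are collected at the element with the edge in its
  \<open>A_elem\<close>, momentum variations at the one with the edge in its \<open>B_elem\<close>.
  There is at most one such element in each case, so each edge variation meets at most one
  residual.\<close>

lemma first_variation_action_sum:
  fixes D :: "('q::real_normed_vector, 'e::real_vector) discretization"
    and \<phi> \<delta>\<phi> :: "edge \<Rightarrow> 'q" and \<pi> \<delta>\<pi> :: "edge \<Rightarrow> 'q dual"
  assumes bidual: "bij (bidual_embed :: 'q \<Rightarrow> 'q dual dual)"
    and NM: "0 < N" "0 < M"
    and diff: "\<And>a b. a < N \<Longrightarrow> b < M \<Longrightarrow> bdry_ham_differentiable D dt dx a b"
    and \<delta>\<phi>: "\<And>e. e \<in> A_mesh N M \<Longrightarrow> \<delta>\<phi> e = 0"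
    and \<delta>\<pi>: "\<And>e. e \<in> B_mesh N M \<Longrightarrow> \<delta>\<pi> e = 0"
  shows "((\<lambda>\<epsilon>. action_sum D N M dt dx (\<lambda>e. \<phi> e + \<epsilon> *\<^sub>R \<delta>\<phi> e) (\<lambda>e. \<pi> e + \<epsilon> *\<^sub>R \<delta>\<pi> e))
     has_real_derivative
      (\<Sum>a<N. \<Sum>b<M.
          blinfun_apply (ham_partial D1 D dt dx \<phi> \<pi> a b - dt *\<^sub>R \<pi> (Temporal a b)) (\<delta>\<phi> (Temporal a b))
        + blinfun_apply (ham_partial D2 D dt dx \<phi> \<pi> a b - dx *\<^sub>R \<pi> (Spatial a b)) (\<delta>\<phi> (Spatial a b))
        + blinfun_apply (\<delta>\<pi> (Temporal a (Suc b))) (ham_partial D3 D dt dx \<phi> \<pi> a b - dt *\<^sub>R \<phi> (Temporal a (Suc b)))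
        + blinfun_apply (\<delta>\<pi> (Spatial (Suc a) b)) (ham_partial D4 D dt dx \<phi> \<pi> a b - dx *\<^sub>R \<phi> (Spatial (Suc a) b))))
     (at 0)"
proof -
  \<comment> \<open>\<open>X\<close> and \<open>Y\<close> are the two halves of the product rule for
    the pairing on an edge: the field varied, and the momentum varied.\<close>
  define X where "X e = blinfun_apply (\<pi> e) (\<delta>\<phi> e)" for e
  define Y where "Y e = blinfun_apply (\<delta>\<pi> e) (\<phi> e)" for e
  define h where "h a b = blinfun_apply (ham_partial D1 D dt dx \<phi> \<pi> a b) (\<delta>\<phi> (Temporal a b))
      + blinfun_apply (ham_partial D2 D dt dx \<phi> \<pi> a b) (\<delta>\<phi> (Spatial a b))
      + blinfun_apply (\<delta>\<pi> (Temporal a (Suc b))) (ham_partial D3 D dt dx \<phi> \<pi> a b)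
      + blinfun_apply (\<delta>\<pi> (Spatial (Suc a) b)) (ham_partial D4 D dt dx \<phi> \<pi> a b)" for a b
  have pair: "((\<lambda>\<epsilon>. blinfun_apply (\<pi> e + \<epsilon> *\<^sub>R \<delta>\<pi> e) (\<phi> e + \<epsilon> *\<^sub>R \<delta>\<phi> e) * c)
      has_real_derivative (X e + Y e) * c) (at 0)" for e c
    unfolding X_def Y_def by (intro DERIV_cmult_right DERIV_pairing_line)
  have ham: "((\<lambda>\<epsilon>. bdry_ham D dt dx a b
        (\<phi> (Temporal a b) + \<epsilon> *\<^sub>R \<delta>\<phi> (Temporal a b))
        (\<phi> (Spatial a b) + \<epsilon> *\<^sub>R \<delta>\<phi> (Spatial a b))
        (\<pi> (Temporal a (Suc b)) + \<epsilon> *\<^sub>R \<delta>\<pi> (Temporal a (Suc b)))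
        (\<pi> (Spatial (Suc a) b) + \<epsilon> *\<^sub>R \<delta>\<pi> (Spatial (Suc a) b)))
      has_real_derivative h a b) (at 0)" if "a < N" "b < M" for a b
    unfolding h_def ham_partial_def
    using diff[OF that] by (intro DERIV_affine_line[OF bidual]) (simp add: bdry_ham_differentiable_def)
  have deriv: "((\<lambda>\<epsilon>. action_sum D N M dt dx (\<lambda>e. \<phi> e + \<epsilon> *\<^sub>R \<delta>\<phi> e) (\<lambda>e. \<pi> e + \<epsilon> *\<^sub>R \<delta>\<pi> e))
     has_real_derivative
      (\<Sum>a<N. (X (Temporal a M) + Y (Temporal a M)) * dt)
    + (\<Sum>b<M. (X (Spatial N b) + Y (Spatial N b)) * dx)
    - (\<Sum>a<N. \<Sum>b<M. (X (Temporal a (Suc b)) + Y (Temporal a (Suc b))) * dt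
        + (X (Spatial (Suc a) b) + Y (Spatial (Suc a) b)) * dx - h a b)) (at 0)"
    unfolding action_sum_def Suc_eq_plus1[symmetric]
    by (intro DERIV_add DERIV_diff DERIV_sum pair ham) auto
  \<comment> \<open>The conditions on the variations enter here: \<open>X\<close> vanishes at the
    inflow end because \<open>\<delta>\<phi>\<close> does, \<open>Y\<close> at the outflow end
    because \<open>\<delta>\<pi>\<close> does.\<close>
  have zeroT: "X (Temporal a 0) = 0" "Y (Temporal a M) = 0" if "a < N" for a
    using that NM by (simp_all add: X_def Y_def \<delta>\<phi> \<delta>\<pi> Temporal_A_mesh Temporal_B_mesh)
  have zeroS: "X (Spatial 0 b) = 0" "Y (Spatial N b) = 0" if "b < M" for b
    using that NM by (simp_all add: X_def Y_def \<delta>\<phi> \<delta>\<pi> Spatial_A_mesh Spatial_B_mesh)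
  \<comment> \<open>Only \<open>X\<close> is shifted, since \<open>Y\<close> already sits on the far
    edges where its residuals are wanted. The lower end term is zero; the upper one will cancel the
    boundary sum of the action.\<close>
  have T: "(\<Sum>a<N. \<Sum>b<M. X (Temporal a (Suc b)) * dt)
      = (\<Sum>a<N. \<Sum>b<M. X (Temporal a b) * dt) + (\<Sum>a<N. X (Temporal a M) * dt)"
    by (subst sum_shift) (simp add: zeroT sum.distrib)
  have S: "(\<Sum>a<N. \<Sum>b<M. X (Spatial (Suc a) b) * dx)
      = (\<Sum>a<N. \<Sum>b<M. X (Spatial a b) * dx) + (\<Sum>b<M. X (Spatial N b) * dx)"
    by (subst sum_shift) (simp add: zeroS)
  have bdry: "(\<Sum>a<N. Y (Temporal a M) * dt) = 0" "(\<Sum>b<M. Y (Spatial N b) * dx) = 0"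
    by (simp_all add: zeroT zeroS)
  have "(\<Sum>a<N. (X (Temporal a M) + Y (Temporal a M)) * dt)
    + (\<Sum>b<M. (X (Spatial N b) + Y (Spatial N b)) * dx)
    - (\<Sum>a<N. \<Sum>b<M. (X (Temporal a (Suc b)) + Y (Temporal a (Suc b))) * dt
        + (X (Spatial (Suc a) b) + Y (Spatial (Suc a) b)) * dx - h a b)
    = (\<Sum>a<N. \<Sum>b<M. h a b - X (Temporal a b) * dt - X (Spatial a b) * dx
        - Y (Temporal a (Suc b)) * dt - Y (Spatial (Suc a) b) * dx)"
    by (simp only: distrib_right sum.distrib sum_subtractf T S bdry)
  also have "\<dots> = (\<Sum>a<N. \<Sum>b<M.
          blinfun_apply (ham_partial D1 D dt dx \<phi> \<pi> a b - dt *\<^sub>R \<pi> (Temporal a b)) (\<delta>\<phi> (Temporal a b))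
        + blinfun_apply (ham_partial D2 D dt dx \<phi> \<pi> a b - dx *\<^sub>R \<pi> (Spatial a b)) (\<delta>\<phi> (Spatial a b))
        + blinfun_apply (\<delta>\<pi> (Temporal a (Suc b))) (ham_partial D3 D dt dx \<phi> \<pi> a b - dt *\<^sub>R \<phi> (Temporal a (Suc b)))
        + blinfun_apply (\<delta>\<pi> (Spatial (Suc a) b)) (ham_partial D4 D dt dx \<phi> \<pi> a b - dx *\<^sub>R \<phi> (Spatial (Suc a) b)))"
    by (intro sum.cong refl) (simp add: h_def X_def Y_def blinfun.diff_left blinfun.diff_right
        blinfun.scaleR_left blinfun.scaleR_right algebra_simps)
  finally show ?thesis
    using deriv by simp
qed

section \<open>Testing with variations supported on one edge\<close>

lemma sum_sum_delta:
  fixes f :: "nat \<Rightarrow> nat \<Rightarrow> 'a::comm_monoid_add"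
  assumes "a < N" "b < (M::nat)"
  shows "(\<Sum>i<N. \<Sum>j<M. if i = a \<and> j = b then f i j else 0) = f a b"
proof -
  have "(\<Sum>i<N. \<Sum>j<M. if i = a \<and> j = b then f i j else 0)
      = (\<Sum>i<N. if i = a then (\<Sum>j<M. if j = b then f i j else 0) else 0)"
    by (intro sum.cong refl) auto
  then show ?thesis using assms by simp
qed

text \<open>A variation supported on a single edge isolates one residual of one element. The guards
  express admissibility: the edge has to avoid the boundary part on which that kind of variation
  must vanish.\<close>

lemma type_II_stationary_imp_equations:
  fixes D :: "('q::real_normed_vector, 'e::real_vector) discretization"
    and \<phi> :: "edge \<Rightarrow> 'q" and \<pi> :: "edge \<Rightarrow> 'q dual"
  assumes bidual: "bij (bidual_embed :: 'q \<Rightarrow> 'q dual dual)"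
    and NM: "0 < N" "0 < M"
    and pos: "0 < dt" "0 < dx"
    and diff: "\<And>a b. a < N \<Longrightarrow> b < M \<Longrightarrow> bdry_ham_differentiable D dt dx a b"
    and stat: "type_II_stationary D N M dt dx \<phi> \<pi>"
    and ab: "a < N" "b < M"
  shows "Temporal a b \<notin> A_mesh N M \<Longrightarrow> \<pi> (Temporal a b) = (1 / dt) *\<^sub>R ham_partial D1 D dt dx \<phi> \<pi> a b"
    and "Spatial a b \<notin> A_mesh N M \<Longrightarrow> \<pi> (Spatial a b) = (1 / dx) *\<^sub>R ham_partial D2 D dt dx \<phi> \<pi> a b"
    and "Temporal a (Suc b) \<notin> B_mesh N M \<Longrightarrow> \<phi> (Temporal a (Suc b)) = (1 / dt) *\<^sub>R ham_partial D3 D dt dx \<phi> \<pi> a b"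
    and "Spatial (Suc a) b \<notin> B_mesh N M \<Longrightarrow> \<phi> (Spatial (Suc a) b) = (1 / dx) *\<^sub>R ham_partial D4 D dt dx \<phi> \<pi> a b"
proof -
  \<comment> \<open>The explicit formula and stationarity both give the derivative at 0, so
    uniqueness of derivatives makes the formula zero.\<close>
  have var: "(\<Sum>a<N. \<Sum>b<M.
          blinfun_apply (ham_partial D1 D dt dx \<phi> \<pi> a b - dt *\<^sub>R \<pi> (Temporal a b)) (\<delta>\<phi> (Temporal a b))
        + blinfun_apply (ham_partial D2 D dt dx \<phi> \<pi> a b - dx *\<^sub>R \<pi> (Spatial a b)) (\<delta>\<phi> (Spatial a b))
        + blinfun_apply (\<delta>\<pi> (Temporal a (Suc b))) (ham_partial D3 D dt dx \<phi> \<pi> a b - dt *\<^sub>R \<phi> (Temporal a (Suc b)))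
        + blinfun_apply (\<delta>\<pi> (Spatial (Suc a) b)) (ham_partial D4 D dt dx \<phi> \<pi> a b - dx *\<^sub>R \<phi> (Spatial (Suc a) b))) = 0"
    if "\<forall>e\<in>A_mesh N M. \<delta>\<phi> e = 0" "\<forall>e\<in>B_mesh N M. \<delta>\<pi> e = 0" for \<delta>\<phi> \<delta>\<pi>
  proof (rule DERIV_unique[OF first_variation_action_sum[OF bidual NM diff that[rule_format]]])
    show "((\<lambda>\<epsilon>. action_sum D N M dt dx (\<lambda>e. \<phi> e + \<epsilon> *\<^sub>R \<delta>\<phi> e) (\<lambda>e. \<pi> e + \<epsilon> *\<^sub>R \<delta>\<pi> e))
      has_real_derivative 0) (at 0)"
      using stat that by (simp add: type_II_stationary_def)
  qed
  \<comment> \<open>Moves an edge indicator through either slot of the pairing, so that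
    \<open>sum_sum_delta\<close> can collapse the double sum.\<close>
  have vanish: "blinfun_apply f (if P then x else 0) = (if P then blinfun_apply f x else 0)"
    "blinfun_apply (if P then k else 0) z = (if P then blinfun_apply k z else 0)"
    for f k :: "'q dual" and x z P by auto
  show "\<pi> (Temporal a b) = (1 / dt) *\<^sub>R ham_partial D1 D dt dx \<phi> \<pi> a b" if "Temporal a b \<notin> A_mesh N M"
  proof -
    have "blinfun_apply (ham_partial D1 D dt dx \<phi> \<pi> a b - dt *\<^sub>R \<pi> (Temporal a b)) x = 0" for x
    proof -
      \<comment> \<open>A field variation with arbitrary value \<open>x\<close> on this one edge:
        only the \<open>D1\<close> pairing of element \<open>a\<close>, \<open>b\<close> sees
        it.\<close>
      have "\<forall>e\<in>A_mesh N M. (if e = Temporal a b then x else 0) = 0"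
        using that by auto
      from var[OF this, where \<delta>\<pi> = "\<lambda>e. 0"] show ?thesis
        by (simp add: vanish sum_sum_delta[OF ab])
    qed
    then have "ham_partial D1 D dt dx \<phi> \<pi> a b - dt *\<^sub>R \<pi> (Temporal a b) = 0" by (intro blinfun_eqI) simp
    then show ?thesis using pos by simp
  qed
  show "\<pi> (Spatial a b) = (1 / dx) *\<^sub>R ham_partial D2 D dt dx \<phi> \<pi> a b" if "Spatial a b \<notin> A_mesh N M"
  proof -
    have "blinfun_apply (ham_partial D2 D dt dx \<phi> \<pi> a b - dx *\<^sub>R \<pi> (Spatial a b)) x = 0" for x
    proof -
      have "\<forall>e\<in>A_mesh N M. (if e = Spatial a b then x else 0) = 0"
        using that by auto
      from var[OF this, where \<delta>\<pi> = "\<lambda>e. 0"] show ?thesis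
        by (simp add: vanish sum_sum_delta[OF ab])
    qed
    then have "ham_partial D2 D dt dx \<phi> \<pi> a b - dx *\<^sub>R \<pi> (Spatial a b) = 0" by (intro blinfun_eqI) simp
    then show ?thesis using pos by simp
  qed
  show "\<phi> (Temporal a (Suc b)) = (1 / dt) *\<^sub>R ham_partial D3 D dt dx \<phi> \<pi> a b" if "Temporal a (Suc b) \<notin> B_mesh N M"
  proof -
    have "blinfun_apply k (ham_partial D3 D dt dx \<phi> \<pi> a b - dt *\<^sub>R \<phi> (Temporal a (Suc b))) = 0" for k :: "'q dual"
    proof -
      \<comment> \<open>The momentum counterpart: among the far temporal edges this one belongs to
        element \<open>a\<close>, \<open>b\<close> alone, so only its \<open>D3\<close> pairing
        survives.\<close>
      have "\<forall>e\<in>B_mesh N M. (if e = Temporal a (Suc b) then k else 0) = 0"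
        using that by auto
      from var[OF _ this, where \<delta>\<phi> = "\<lambda>e. 0"] show ?thesis
        by (simp add: vanish sum_sum_delta[OF ab])
    qed
    \<comment> \<open>This residual is a field value, so it is tested against all momenta through
      the bidual identification.\<close>
    then have "ham_partial D3 D dt dx \<phi> \<pi> a b - dt *\<^sub>R \<phi> (Temporal a (Suc b)) = 0"
      by (intro bidual_embed_eqI[OF bidual]) simp
    then show ?thesis using pos by simp
  qed
  show "\<phi> (Spatial (Suc a) b) = (1 / dx) *\<^sub>R ham_partial D4 D dt dx \<phi> \<pi> a b" if "Spatial (Suc a) b \<notin> B_mesh N M"
  proof -
    have "blinfun_apply k (ham_partial D4 D dt dx \<phi> \<pi> a b - dx *\<^sub>R \<phi> (Spatial (Suc a) b)) = 0" for k :: "'q dual"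
    proof -
      have "\<forall>e\<in>B_mesh N M. (if e = Spatial (Suc a) b then k else 0) = 0"
        using that by auto
      from var[OF _ this, where \<delta>\<phi> = "\<lambda>e. 0"] show ?thesis
        by (simp add: vanish sum_sum_delta[OF ab])
    qed
    then have "ham_partial D4 D dt dx \<phi> \<pi> a b - dx *\<^sub>R \<phi> (Spatial (Suc a) b) = 0"
      by (intro bidual_embed_eqI[OF bidual]) simp
    then show ?thesis using pos by simp
  qed
qed

section \<open>Completing the boundary values\<close>

text \<open>Adding one variation to both pairs preserves their agreement off the two boundary parts,
  so their action sums coincide for every \<open>\<epsilon>\<close>. Completing a stationary pair
  thus keeps it stationary.\<close>

lemma type_II_stationary_cong:
  assumes NM: "0 < N" "0 < M"
    and \<phi>: "\<forall>e. e \<notin> B_mesh N M \<longrightarrow> \<phi>' e = \<phi> e"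
    and \<pi>: "\<forall>e. e \<notin> A_mesh N M \<longrightarrow> \<pi>' e = \<pi> e"
  shows "type_II_stationary D N M dt dx \<phi>' \<pi>' \<longleftrightarrow> type_II_stationary D N M dt dx \<phi> \<pi>"
proof -
  have "action_sum D N M dt dx (\<lambda>e. \<phi>' e + \<epsilon> *\<^sub>R \<delta>\<phi> e) (\<lambda>e. \<pi>' e + \<epsilon> *\<^sub>R \<delta>\<pi> e)
      = action_sum D N M dt dx (\<lambda>e. \<phi> e + \<epsilon> *\<^sub>R \<delta>\<phi> e) (\<lambda>e. \<pi> e + \<epsilon> *\<^sub>R \<delta>\<pi> e)" for \<epsilon> \<delta>\<phi> \<delta>\<pi>
    by (rule action_sum_cong[OF NM]) (simp_all add: \<phi> \<pi>)
  then show ?thesis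
    unfolding type_II_stationary_def by simp
qed

lemma forward_hamilton_phiA_piB_iff:
  "forward_hamilton D dt dx a b (phiA_piB a b \<phi> \<pi>) (phiB_piA a b \<phi> \<pi>) \<longleftrightarrow>
     \<pi> (Temporal a b) = (1 / dt) *\<^sub>R ham_partial D1 D dt dx \<phi> \<pi> a b \<and>
     \<pi> (Spatial a b) = (1 / dx) *\<^sub>R ham_partial D2 D dt dx \<phi> \<pi> a b \<and>
     \<phi> (Temporal a (Suc b)) = (1 / dt) *\<^sub>R ham_partial D3 D dt dx \<phi> \<pi> a b \<and>
     \<phi> (Spatial (Suc a) b) = (1 / dx) *\<^sub>R ham_partial D4 D dt dx \<phi> \<pi> a b"
  by (simp add: forward_hamilton_def phiA_piB_def phiB_piA_def ham_partial_def)

text \<open>Near edges of an element never lie in \<open>B_mesh\<close>, nor far edges in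
  \<open>A_mesh\<close>, so a completion leaves the arguments of every element Hamiltonian
  unchanged. This makes the equations explicit formulas for the missing values.\<close>

lemma ham_partial_cong:
  assumes NM: "0 < N" "0 < M" and ab: "a < N" "b < M"
    and \<phi>: "\<forall>e. e \<notin> B_mesh N M \<longrightarrow> \<phi>' e = \<phi> e"
    and \<pi>: "\<forall>e. e \<notin> A_mesh N M \<longrightarrow> \<pi>' e = \<pi> e"
  shows "ham_partial F D dt dx \<phi>' \<pi>' a b = ham_partial F D dt dx \<phi> \<pi> a b"
proof -
  have "\<phi>' (Temporal a b) = \<phi> (Temporal a b)" "\<phi>' (Spatial a b) = \<phi> (Spatial a b)"
    "\<pi>' (Temporal a (Suc b)) = \<pi> (Temporal a (Suc b))" "\<pi>' (Spatial (Suc a) b) = \<pi> (Spatial (Suc a) b)"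
    using NM ab by (auto intro!: \<phi>[rule_format] \<pi>[rule_format]
        simp: Temporal_A_mesh Spatial_A_mesh Temporal_B_mesh Spatial_B_mesh)
  then show ?thesis by (simp add: ham_partial_def)
qed

lemma forward_hamilton_functional:
  "\<exists>\<Phi>. \<forall>z w. forward_hamilton D dt dx a b z w \<longleftrightarrow> w = \<Phi> z"
  \<comment> \<open>The output lists field values before momenta, hence \<open>D3\<close> and
    \<open>D4\<close> come before \<open>D1\<close> and \<open>D2\<close>.\<close>
  by (rule exI[of _ "\<lambda>(u, v, p, r).
      ((1 / dt) *\<^sub>R D3 (bdry_ham D dt dx a b) u v p r, (1 / dx) *\<^sub>R D4 (bdry_ham D dt dx a b) u v p r,
       (1 / dt) *\<^sub>R D1 (bdry_ham D dt dx a b) u v p r, (1 / dx) *\<^sub>R D2 (bdry_ham D dt dx a b) u v p r)"])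
    (auto simp: forward_hamilton_def)

text \<open>The missing values are read off the equations of the elements along the boundary, and
  the same equations force them.\<close>

lemma ex1_boundary_completion:
  fixes D :: "('q::real_normed_vector, 'e::real_vector) discretization"
    and \<phi> :: "edge \<Rightarrow> 'q" and \<pi> :: "edge \<Rightarrow> 'q dual"
  assumes bidual: "bij (bidual_embed :: 'q \<Rightarrow> 'q dual dual)"
    and NM: "0 < N" "0 < M"
    and pos: "0 < dt" "0 < dx"
    and diff: "\<And>a b. a < N \<Longrightarrow> b < M \<Longrightarrow> bdry_ham_differentiable D dt dx a b"
    and stat: "type_II_stationary D N M dt dx \<phi> \<pi>"
  shows "\<exists>!(\<phi>', \<pi>').
         (\<forall>e. e \<notin> B_mesh N M \<longrightarrow> \<phi>' e = \<phi> e) \<and> (\<forall>e. e \<notin> A_mesh N M \<longrightarrow> \<pi>' e = \<pi> e) \<and>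
         type_II_stationary D N M dt dx \<phi>' \<pi>' \<and>
         (\<forall>a<N. \<forall>b<M.
            forward_hamilton D dt dx a b (phiA_piB a b \<phi>' \<pi>') (phiB_piA a b \<phi>' \<pi>'))"
proof -
  note mesh = Temporal_A_mesh[OF NM(2)] Spatial_A_mesh[OF NM(1)]
    Temporal_B_mesh[OF NM(2)] Spatial_B_mesh[OF NM(1)]
  \<comment> \<open>An outflow edge is a far edge, so its element lies one step back: hence
    \<open>b - 1\<close> and \<open>a - 1\<close>. An inflow edge carries the indices of its own
    element, so \<open>\<pi>A\<close> has no shift.\<close>
  define \<phi>B where "\<phi>B e = (if e \<in> B_mesh N M then case e of
        Temporal a b \<Rightarrow> (1 / dt) *\<^sub>R ham_partial D3 D dt dx \<phi> \<pi> a (b - 1)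
      | Spatial a b \<Rightarrow> (1 / dx) *\<^sub>R ham_partial D4 D dt dx \<phi> \<pi> (a - 1) b else \<phi> e)" for e
  define \<pi>A where "\<pi>A e = (if e \<in> A_mesh N M then case e of
        Temporal a b \<Rightarrow> (1 / dt) *\<^sub>R ham_partial D1 D dt dx \<phi> \<pi> a b
      | Spatial a b \<Rightarrow> (1 / dx) *\<^sub>R ham_partial D2 D dt dx \<phi> \<pi> a b else \<pi> e)" for e
  have off: "\<forall>e. e \<notin> B_mesh N M \<longrightarrow> \<phi>B e = \<phi> e" "\<forall>e. e \<notin> A_mesh N M \<longrightarrow> \<pi>A e = \<pi> e"
    by (simp_all add: \<phi>B_def \<pi>A_def)
  note eqs = type_II_stationary_imp_equations[OF bidual NM pos diff stat]
  \<comment> \<open>On the completed edges the equations hold by construction, on all others by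
    stationarity of the original pair.\<close>
  have fwd: "forward_hamilton D dt dx a b (phiA_piB a b \<phi>B \<pi>A) (phiB_piA a b \<phi>B \<pi>A)"
    if ab: "a < N" "b < M" for a b
    unfolding forward_hamilton_phiA_piB_iff ham_partial_cong[OF NM ab off]
    using eqs[OF _ _ ab] by (simp add: \<phi>B_def \<pi>A_def)
  have unique: "\<phi>' = \<phi>B \<and> \<pi>' = \<pi>A"
    if \<phi>': "\<forall>e. e \<notin> B_mesh N M \<longrightarrow> \<phi>' e = \<phi> e"
      and \<pi>': "\<forall>e. e \<notin> A_mesh N M \<longrightarrow> \<pi>' e = \<pi> e"
      and f: "\<And>a b. a < N \<Longrightarrow> b < M \<Longrightarrow>
        forward_hamilton D dt dx a b (phiA_piB a b \<phi>' \<pi>') (phiB_piA a b \<phi>' \<pi>')" for \<phi>' \<pi>'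
  proof -
    \<comment> \<open>After \<open>ham_partial_cong\<close> the right-hand sides mention only the
      original \<open>\<phi>\<close> and \<open>\<pi>\<close>, so they are the same for every
      completion.\<close>
    have eq: "\<pi>' (Temporal a b) = (1 / dt) *\<^sub>R ham_partial D1 D dt dx \<phi> \<pi> a b"
      "\<pi>' (Spatial a b) = (1 / dx) *\<^sub>R ham_partial D2 D dt dx \<phi> \<pi> a b"
      "\<phi>' (Temporal a (Suc b)) = (1 / dt) *\<^sub>R ham_partial D3 D dt dx \<phi> \<pi> a b"
      "\<phi>' (Spatial (Suc a) b) = (1 / dx) *\<^sub>R ham_partial D4 D dt dx \<phi> \<pi> a b"
      if ab: "a < N" "b < M" for a b
      using f[OF ab]
      unfolding forward_hamilton_phiA_piB_iff ham_partial_cong[OF NM ab \<phi>' \<pi>'] by simp_all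
    have "\<phi>' e = \<phi>B e" for e
      \<comment> \<open>The outflow edges are the far edges of the elements with last index,
        \<open>M - 1\<close> or \<open>N - 1\<close>.\<close>
      using \<phi>' eq(3)[of _ "M - 1"] eq(4)[of "N - 1"] NM
      by (cases e) (auto simp: \<phi>B_def mesh)
    moreover have "\<pi>' e = \<pi>A e" for e
      using \<pi>' eq(1)[of _ 0] eq(2)[of 0] NM
      by (cases e) (auto simp: \<pi>A_def mesh)
    ultimately show ?thesis by blast
  qed
  show ?thesis
  proof (rule ex1I[of _ "(\<phi>B, \<pi>A)"], goal_cases)
    case 1
    then show ?case
      using off fwd stat by (simp add: type_II_stationary_cong[OF NM off])
  next
    case (2 z)
    then show ?case
      using unique[of "fst z" "snd z"] by (auto simp: case_prod_unfold prod_eq_iff)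
  qed
qed

text \<open>By \<open>action_sum_cong\<close>, stationarity cannot fix \<open>\<phi>\<close> on
  \<open>B_mesh\<close> or \<open>\<pi>\<close> on \<open>A_mesh\<close>. The claim for every
  element therefore has two layers: guarded equations for the given pair, then a unique choice of
  the unseen values that satisfies all of them. The last conjunct reads the equations as the graph
  of a map.\<close>

theorem proposition2p1:
  fixes D :: "('q::real_normed_vector, 'e::real_vector) discretization"
    and N M :: nat and dt dx :: real
  assumes "bij (bidual_embed :: 'q \<Rightarrow> 'q dual dual)"
    and "0 < N" and "0 < M" and "0 < dt" and "0 < dx"
    and "\<forall>a<N. \<forall>b<M. linear_traces D a b"
    and "\<forall>a<N. \<forall>b<M. bdry_ham_well_defined D dt dx a b"
    and "\<forall>a<N. \<forall>b<M. bdry_ham_differentiable D dt dx a b"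
  shows
    "(\<forall>\<phi> \<pi>. type_II_stationary D N M dt dx \<phi> \<pi> \<longrightarrow>
       (\<forall>a<N. \<forall>b<M.
         let H = bdry_ham D dt dx a b;
             u = \<phi> (Temporal a b); v = \<phi> (Spatial a b);
             p = \<pi> (Temporal a (b + 1)); r = \<pi> (Spatial (a + 1) b)
         in (Temporal a b \<notin> A_mesh N M \<longrightarrow> \<pi> (Temporal a b) = (1 / dt) *\<^sub>R D1 H u v p r) \<and>
            (Spatial a b \<notin> A_mesh N M \<longrightarrow> \<pi> (Spatial a b) = (1 / dx) *\<^sub>R D2 H u v p r) \<and>
            (Temporal a (b + 1) \<notin> B_mesh N M \<longrightarrow>
               \<phi> (Temporal a (b + 1)) = (1 / dt) *\<^sub>R D3 H u v p r) \<and>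
            (Spatial (a + 1) b \<notin> B_mesh N M \<longrightarrow>
               \<phi> (Spatial (a + 1) b) = (1 / dx) *\<^sub>R D4 H u v p r)) \<and>
       (\<exists>!(\<phi>', \<pi>').
         (\<forall>e. e \<notin> B_mesh N M \<longrightarrow> \<phi>' e = \<phi> e) \<and> (\<forall>e. e \<notin> A_mesh N M \<longrightarrow> \<pi>' e = \<pi> e) \<and>
         type_II_stationary D N M dt dx \<phi>' \<pi>' \<and>
         (\<forall>a<N. \<forall>b<M.
            forward_hamilton D dt dx a b (phiA_piB a b \<phi>' \<pi>') (phiB_piA a b \<phi>' \<pi>')))) \<and>
     (\<forall>a<N. \<forall>b<M. \<exists>\<Phi>. \<forall>\<phi>A_\<pi>B \<phi>B_\<pi>A.
        forward_hamilton D dt dx a b \<phi>A_\<pi>B \<phi>B_\<pi>A \<longleftrightarrow> \<phi>B_\<pi>A = \<Phi> \<phi>A_\<pi>B)"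
proof (intro conjI allI impI, goal_cases)
  case (1 \<phi> \<pi> a b)
  have "\<And>a b. a < N \<Longrightarrow> b < M \<Longrightarrow> bdry_ham_differentiable D dt dx a b"
    using assms(8) by blast
  from type_II_stationary_imp_equations[OF assms(1-5) this 1] show ?case
    by (simp add: Let_def ham_partial_def)
next
  case (2 \<phi> \<pi>)
  with assms show ?case
    by (intro ex1_boundary_completion) auto
next
  case (3 a b)
  show ?case by (rule forward_hamilton_functional)
qed

end
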